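(* Let $(\mathfrak g,\{J_1,J_2,J_3\})$ be a $2$-step nilpotent hypercomplex Lie algebra. If at least one of the three complex structures $J_1,J_2,J_3$ is $2$-step nilpotent, then $(\mathfrak g,\{J_\alpha\})$ is Obata flat, i.e. the curvature tensor of the Obata connection vanishes identically.
   Context: Lie algebras are real and finite-dimensional. A complex structure on a Lie algebra $\mathfrak g$ is an endomorphism $J$ with $J^2=-I$ and $[X,Y]+J([JX,Y]+[X,JY])-[JX,JY]=0$ for all $X,Y\in\mathfrak g$. A hypercomplex Lie algebra is a Lie algebra with three complex structures $J_1,J_2,J_3$ such that $J_1J_2=-J_2J_1=J_3$. A Lie algebra $\mathfrak g$ is $2$-step nilpotent if $\mathfrak g^1=[\mathfrak g,\mathfrak g]$ is nonzero and contained in the center of $\mathfrak g$. Given a complex structure $J$ on a nilpotent Lie algebra $\mathfrak g$, set $\mathfrak a_0=0$ and $\mathfrak a_k=\{X\in\mathfrak g\mid [X,\mathfrak g]\subset\mathfrak a_{k-1}\text{ and }[JX,\mathfrak g]\subset\mathfrak a_{k-1}\}$ for $k\ge1$. $J$ is nilpotent if $\mathfrak a_k=\mathfrak g$ for some $k$, and the smallest such $k$ is its nilpotency step; $J$ is $k$-step nilpotent if its nilpotency step is $k$. The Obata connection of a hypercomplex Lie algebra is the bilinear map $\nabla:\mathfrak g\times\mathfrak g\to\mathfrak g$, $$\nabla_XY=\tfrac12\big([X,Y]+J_1[J_1X,Y]-J_2[X,J_2Y]+J_3[J_1X,J_2Y]\big),$$ the unique one with $\nabla_XY-\nabla_YX=[X,Y]$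 and $\nabla_XJ_\alpha=J_\alpha\nabla_X$ for all $\alpha$. Its curvature is $R(X,Y)=\nabla_X\nabla_Y-\nabla_Y\nabla_X-\nabla_{[X,Y]}$. *)

theory Defs
  imports "HOL-Analysis.Analysis"
begin

text \<open>
  The underlying vector space of a Lie algebra is a whole type of class
  \<open>real_vector\<close>; the bracket is an explicit argument.
\<close>

definition lie_algebra :: "('a::real_vector \<Rightarrow> 'a \<Rightarrow> 'a) \<Rightarrow> bool" where
  "lie_algebra br \<longleftrightarrow>
     (\<exists>B. finite_dimensional_vector_space ((*\<^sub>R) :: real \<Rightarrow> 'a \<Rightarrow> 'a) B) \<and>
     bilinear br \<and>
     (\<forall>X. br X X = 0) \<and>
     (\<forall>X Y Z. br X (br Y Z) + br Y (br Z X) + br Z (br X Y) = 0)"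

definition lie_center :: "('a::real_vector \<Rightarrow> 'a \<Rightarrow> 'a) \<Rightarrow> 'a set" where
  "lie_center br = {X. \<forall>Y. br X Y = 0}"

definition derived_algebra :: "('a::real_vector \<Rightarrow> 'a \<Rightarrow> 'a) \<Rightarrow> 'a set" where
  "derived_algebra br = span {br X Y | X Y. True}"

definition two_step_nilpotent :: "('a::real_vector \<Rightarrow> 'a \<Rightarrow> 'a) \<Rightarrow> bool" where
  "two_step_nilpotent br \<longleftrightarrow>
     derived_algebra br \<noteq> {0} \<and> derived_algebra br \<subseteq> lie_center br"

definition complex_structure ::
    "('a::real_vector \<Rightarrow> 'a \<Rightarrow> 'a) \<Rightarrow> ('a \<Rightarrow> 'a) \<Rightarrow> bool" where
  "complex_structure br J \<longleftrightarrow>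
     linear J \<and>
     (\<forall>X. J (J X) = - X) \<and>
     (\<forall>X Y. br X Y + J (br (J X) Y + br X (J Y)) - br (J X) (J Y) = 0)"

definition hypercomplex_lie_algebra ::
    "('a::real_vector \<Rightarrow> 'a \<Rightarrow> 'a) \<Rightarrow> ('a \<Rightarrow> 'a) \<Rightarrow> ('a \<Rightarrow> 'a) \<Rightarrow> ('a \<Rightarrow> 'a) \<Rightarrow> bool" where
  "hypercomplex_lie_algebra br J1 J2 J3 \<longleftrightarrow>
     lie_algebra br \<and>
     complex_structure br J1 \<and> complex_structure br J2 \<and> complex_structure br J3 \<and>
     (\<forall>X. J1 (J2 X) = J3 X \<and> - J2 (J1 X) = J3 X)"

primrec ascending_ideal ::
    "('a::real_vector \<Rightarrow> 'a \<Rightarrow> 'a) \<Rightarrow> ('a \<Rightarrow> 'a) \<Rightarrow> nat \<Rightarrow> 'a set" where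
  "ascending_ideal br J 0 = {0}"
| "ascending_ideal br J (Suc k) =
     {X. (\<forall>Y. br X Y \<in> ascending_ideal br J k) \<and> (\<forall>Y. br (J X) Y \<in> ascending_ideal br J k)}"

definition nilpotent_cs ::
    "('a::real_vector \<Rightarrow> 'a \<Rightarrow> 'a) \<Rightarrow> ('a \<Rightarrow> 'a) \<Rightarrow> bool" where
  "nilpotent_cs br J \<longleftrightarrow> (\<exists>k. ascending_ideal br J k = UNIV)"

text \<open>Meaningful only when \<open>nilpotent_cs br J\<close> holds.\<close>

definition nilpotency_step ::
    "('a::real_vector \<Rightarrow> 'a \<Rightarrow> 'a) \<Rightarrow> ('a \<Rightarrow> 'a) \<Rightarrow> nat" where
  "nilpotency_step br J = (LEAST k. ascending_ideal br J k = UNIV)"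

definition step_nilpotent_cs ::
    "nat \<Rightarrow> ('a::real_vector \<Rightarrow> 'a \<Rightarrow> 'a) \<Rightarrow> ('a \<Rightarrow> 'a) \<Rightarrow> bool" where
  "step_nilpotent_cs k br J \<longleftrightarrow> nilpotent_cs br J \<and> nilpotency_step br J = k"

definition obata_connection ::
    "('a::real_vector \<Rightarrow> 'a \<Rightarrow> 'a) \<Rightarrow> ('a \<Rightarrow> 'a) \<Rightarrow> ('a \<Rightarrow> 'a) \<Rightarrow> ('a \<Rightarrow> 'a) \<Rightarrow> 'a \<Rightarrow> 'a \<Rightarrow> 'a" where
  "obata_connection br J1 J2 J3 X Y =
     (1 / 2) *\<^sub>R (br X Y + J1 (br (J1 X) Y) - J2 (br X (J2 Y)) + J3 (br (J1 X) (J2 Y)))"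

definition curvature ::
    "('a::real_vector \<Rightarrow> 'a \<Rightarrow> 'a) \<Rightarrow> ('a \<Rightarrow> 'a \<Rightarrow> 'a) \<Rightarrow> 'a \<Rightarrow> 'a \<Rightarrow> 'a \<Rightarrow> 'a" where
  "curvature br D X Y Z = D X (D Y Z) - D Y (D X Z) - D (br X Y) Z"

definition obata_flat ::
    "('a::real_vector \<Rightarrow> 'a \<Rightarrow> 'a) \<Rightarrow> ('a \<Rightarrow> 'a) \<Rightarrow> ('a \<Rightarrow> 'a) \<Rightarrow> ('a \<Rightarrow> 'a) \<Rightarrow> bool" where
  "obata_flat br J1 J2 J3 \<longleftrightarrow>
     (\<forall>X Y Z. curvature br (obata_connection br J1 J2 J3) X Y Z = 0)"

end

theory Submission
  imports Defs
begin

text \<open>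
  Write \<open>D\<close> for the Obata connection, and suppose first that \<open>J1\<close> is the structure that is
  2-step nilpotent.  Then every bracket \<open>B\<close> is central, and so is \<open>J1 B\<close>.  In the formula for
  \<open>D B Y\<close> each of the four terms is the image of a bracket having \<open>B\<close> or \<open>J1 B\<close> as its first
  entry, so \<open>D B = 0\<close>.  As \<open>D\<close> is torsion-free and \<open>B\<close> is central,
  \<open>D X B = D B X + br X B = 0\<close> as well; and as \<open>D X\<close> commutes with the \<open>J\<alpha>\<close>, it kills
  \<open>J1 B\<close>, \<open>J2 B\<close> and \<open>J3 B\<close>.  But \<open>D Y Z\<close> is a combination of brackets and their images under
  the \<open>J\<alpha>\<close>.  So \<open>D X (D Y Z) = 0\<close>, and each of the three terms of the curvature vanishes.

  The formula for \<open>D\<close> treats the three structures differently, whereas the hypothesis allows any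
  of them to be the 2-step nilpotent one.  A torsion-free connection that commutes with the
  \<open>J\<alpha>\<close> is determined by the bracket.  A cyclic permutation of the three structures yields again
  a hypercomplex Lie algebra, and its connection has the same two properties.  Hence \<open>D\<close> is
  invariant under the permutation, and the structure in question may be rotated into the place of
  \<open>J1\<close>.
\<close>

locale hypercomplex =
  fixes br :: "'a::real_vector \<Rightarrow> 'a \<Rightarrow> 'a"
    and J1 J2 J3 :: "'a \<Rightarrow> 'a"
  assumes hypercomplex: "hypercomplex_lie_algebra br J1 J2 J3"
begin

abbreviation D :: "'a \<Rightarrow> 'a \<Rightarrow> 'a" where
  "D \<equiv> obata_connection br J1 J2 J3"

lemma linear_J: "linear J1" "linear J2" "linear J3"
  using hypercomplex by (auto simp: hypercomplex_lie_algebra_def complex_structure_def)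

lemmas J_simps [simp] =
  linear_J[THEN linear_add] linear_J[THEN linear_diff] linear_J[THEN linear_neg]
  linear_J[THEN linear_0] linear_J[THEN linear_cmul]

lemma bilinear_br: "bilinear br"
  using hypercomplex by (simp add: hypercomplex_lie_algebra_def lie_algebra_def)

lemmas br_simps [simp] =
  bilinear_ladd[OF bilinear_br] bilinear_radd[OF bilinear_br]
  bilinear_lneg[OF bilinear_br] bilinear_rneg[OF bilinear_br]
  bilinear_lsub[OF bilinear_br] bilinear_rsub[OF bilinear_br]
  bilinear_lzero[OF bilinear_br] bilinear_rzero[OF bilinear_br]
  bilinear_lmul[OF bilinear_br] bilinear_rmul[OF bilinear_br]

lemma br_anticomm: "br X Y = - br Y X"
proof -
  have "br Z Z = 0" for Z
    using hypercomplex by (simp add: hypercomplex_lie_algebra_def lie_algebra_def)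
  from this[of "X + Y"] this[of X] this[of Y] have "br X Y + br Y X = 0"
    by (simp add: add.commute)
  then show ?thesis
    by (simp add: eq_neg_iff_add_eq_0)
qed

lemma quaternion_squares [simp]:
  "J1 (J1 X) = - X" "J2 (J2 X) = - X" "J3 (J3 X) = - X"
  using hypercomplex by (auto simp: hypercomplex_lie_algebra_def complex_structure_def)

lemma quaternion_12 [simp]: "J1 (J2 X) = J3 X" and quaternion_21 [simp]: "J2 (J1 X) = - J3 X"
proof -
  have "J1 (J2 X) = J3 X" "- J2 (J1 X) = J3 X"
    using hypercomplex by (auto simp: hypercomplex_lie_algebra_def)
  then show "J1 (J2 X) = J3 X" "J2 (J1 X) = - J3 X"
    by (metis minus_minus)+
qed

lemma quaternion_13 [simp]: "J1 (J3 X) = - J2 X"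
  using quaternion_squares(1)[of "J2 X"] by simp

lemma quaternion_32 [simp]: "J3 (J2 X) = - J1 X"
  using quaternion_12[of "J2 X"] by simp

lemma quaternion_31 [simp]: "J3 (J1 X) = J2 X"
  using quaternion_12[of "J1 X"] by simp

lemma quaternion_23 [simp]: "J2 (J3 X) = J1 X"
  using quaternion_21[of "J2 X"] by simp

lemma integrable:
  "br (J1 X) (J1 Y) = br X Y + J1 (br (J1 X) Y) + J1 (br X (J1 Y))"
  "br (J2 X) (J2 Y) = br X Y + J2 (br (J2 X) Y) + J2 (br X (J2 Y))"
  "br (J3 X) (J3 Y) = br X Y + J3 (br (J3 X) Y) + J3 (br X (J3 Y))"
proof -
  have "complex_structure br J1" "complex_structure br J2" "complex_structure br J3"
    using hypercomplex by (simp_all add: hypercomplex_lie_algebra_def)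
  then have *: "br X Y + J (br (J X) Y + br X (J Y)) - br (J X) (J Y) = 0"
    if "J = J1 \<or> J = J2 \<or> J = J3" for J
    using that unfolding complex_structure_def by blast
  show
    "br (J1 X) (J1 Y) = br X Y + J1 (br (J1 X) Y) + J1 (br X (J1 Y))"
    "br (J2 X) (J2 Y) = br X Y + J2 (br (J2 X) Y) + J2 (br X (J2 Y))"
    "br (J3 X) (J3 Y) = br X Y + J3 (br (J3 X) Y) + J3 (br X (J3 Y))"
    using *[of J1] *[of J2] *[of J3] by (simp_all add: algebra_simps)
qed

lemma two_obata:
  "2 *\<^sub>R D X Y = br X Y + J1 (br (J1 X) Y) - J2 (br X (J2 Y)) + J3 (br (J1 X) (J2 Y))"
  by (simp add: obata_connection_def)

text \<open>
  Integrability of \<open>J1\<close> and \<open>J2\<close> turns the \<open>J1\<close> and \<open>J2\<close> terms into brackets; what is left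
  besides \<open>2 *\<^sub>R br X Y\<close> is the integrability condition of \<open>J3\<close> at \<open>J1 X\<close> and \<open>J1 Y\<close>,
  because \<open>J3 (J1 X) = J2 X\<close>.
\<close>
lemma obata_torsion_free: "D X Y - D Y X = br X Y"
proof (rule scaleR_left_imp_eq[of 2])
  have "2 *\<^sub>R (D X Y - D Y X) =
      2 *\<^sub>R br X Y + (J1 (br (J1 X) Y) + J1 (br X (J1 Y))) - (J2 (br X (J2 Y)) + J2 (br (J2 X) Y))
        + J3 (br (J1 X) (J2 Y)) + J3 (br (J2 X) (J1 Y))"
    unfolding scaleR_diff_right two_obata
    using br_anticomm[of Y X] br_anticomm[of "J1 Y" X] br_anticomm[of Y "J2 X"]
      br_anticomm[of "J1 Y" "J2 X"]
    by (simp add: scaleR_2)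
  also have "\<dots> = 2 *\<^sub>R br X Y"
    using integrable(1,2)[of X Y] integrable(3)[of "J1 X" "J1 Y"] by (simp add: algebra_simps)
  finally show "2 *\<^sub>R (D X Y - D Y X) = 2 *\<^sub>R br X Y" .
qed simp

text \<open>
  Commutation with \<open>J2\<close> is formal.  Commutation with \<open>J1\<close> uses integrability of \<open>J1\<close> twice, at
  the pairs \<open>(X, Y)\<close> and \<open>(X, J2 Y)\<close>.
\<close>
lemma obata_J:
  "D X (J1 Y) = J1 (D X Y)" "D X (J2 Y) = J2 (D X Y)" "D X (J3 Y) = J3 (D X Y)"
proof -
  show 2: "D X (J2 Y) = J2 (D X Y)" for Y
    by (simp add: obata_connection_def)
  show 1: "D X (J1 Y) = J1 (D X Y)" for Y
    using integrable(1)[of X Y] integrable(1)[of X "J2 Y"]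
    by (simp add: obata_connection_def)
  show "D X (J3 Y) = J3 (D X Y)"
    using 1[of "J2 Y"] 2[of Y] by simp
qed

text \<open>
  The formula of the Obata connection inverts the passage from a connection to its torsion: after
  replacing each bracket by \<open>E A B - E B A\<close> and pulling \<open>J1\<close> and \<open>J2\<close> out of the second slot
  everything cancels except for two copies of \<open>E X Y\<close>.
\<close>
lemma obata_unique:
  assumes "\<And>X Y. E X Y - E Y X = br X Y"
    and "\<And>X Y. E X (J1 Y) = J1 (E X Y)" "\<And>X Y. E X (J2 Y) = J2 (E X Y)"
  shows "E = D"
proof (intro ext)
  show "E X Y = D X Y" for X Y
  proof (rule scaleR_left_imp_eq[of 2])
    show "2 *\<^sub>R E X Y = 2 *\<^sub>R D X Y"
      unfolding two_obata by (simp add: assms(2,3) scaleR_2 flip: assms(1))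
  qed simp
qed

lemma cyclic: "hypercomplex br J2 J3 J1"
  using hypercomplex
  by unfold_locales (simp add: hypercomplex_lie_algebra_def)

lemma obata_cyclic: "obata_connection br J2 J3 J1 = D"
proof -
  interpret rot: hypercomplex br J2 J3 J1
    by (rule cyclic)
  show ?thesis
    by (intro obata_unique rot.obata_torsion_free rot.obata_J)
qed

text \<open>
  The first argument of \<open>D\<close> enters its formula only directly and through \<open>J1\<close>.  This is why the
  second assumption is about \<open>J1\<close> rather than \<open>J2\<close> or \<open>J3\<close>, and why centrality makes \<open>D B\<close>
  vanish for each bracket \<open>B\<close>; torsion-freeness carries this over to \<open>D X B\<close>.
\<close>
lemma obata_flat_if_central:
  assumes br_central: "\<And>X Y Z. br (br X Y) Z = 0"
    and J1_br_central: "\<And>X Y Z. br (J1 (br X Y)) Z = 0"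
  shows "obata_flat br J1 J2 J3"
proof -
  have left: "D (br A B) Y = 0" for A B Y
    by (simp add: obata_connection_def br_central J1_br_central)
  have right: "D X (br A B) = 0" for A B X
    using obata_torsion_free[of "br A B" X] by (simp add: left br_central)
  have linear_D: "linear (D X)" for X
    unfolding obata_connection_def
    by (rule linearI) (simp_all add: algebra_simps)
  have "D X (D Y Z) = 0" for X Y Z
    unfolding obata_connection_def[of br J1 J2 J3 Y Z]
    by (simp add: linear_D[THEN linear_add] linear_D[THEN linear_diff]
        linear_D[THEN linear_cmul] obata_J right)
  then show ?thesis
    by (simp add: obata_flat_def curvature_def left)
qed

end

text \<open>
  Two steps of the ascending series suffice precisely when all brackets lie in the first ideal,
  which consists of the \<open>X\<close> with \<open>X\<close> and \<open>J X\<close> both central.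
\<close>
lemma step_nilpotent_cs_2D:
  assumes "step_nilpotent_cs 2 br J"
  shows "br (br X Y) Z = 0" "br (J (br X Y)) Z = 0"
proof -
  have "ascending_ideal br J 2 = UNIV"
    using assms LeastI_ex[of "\<lambda>k. ascending_ideal br J k = UNIV"]
    by (simp add: step_nilpotent_cs_def nilpotent_cs_def nilpotency_step_def)
  then have "X \<in> ascending_ideal br J 2"
    by simp
  then show "br (br X Y) Z = 0" "br (J (br X Y)) Z = 0"
    by (simp_all add: numeral_2_eq_2)
qed

theorem corollary3p2:
  fixes br :: "'a::real_vector \<Rightarrow> 'a \<Rightarrow> 'a"
    and J1 J2 J3 :: "'a \<Rightarrow> 'a"
  assumes "hypercomplex_lie_algebra br J1 J2 J3"
    and "two_step_nilpotent br"
    and "step_nilpotent_cs 2 br J1 \<or> step_nilpotent_cs 2 br J2 \<or> step_nilpotent_cs 2 br J3"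
  shows "obata_flat br J1 J2 J3"
proof -
  interpret hypercomplex br J1 J2 J3
    by unfold_locales (rule assms(1))
  interpret rot: hypercomplex br J2 J3 J1
    by (rule cyclic)
  interpret rot2: hypercomplex br J3 J1 J2
    by (rule rot.cyclic)
  from assms(3) consider "step_nilpotent_cs 2 br J1" | "step_nilpotent_cs 2 br J2"
    | "step_nilpotent_cs 2 br J3"
    by blast
  then show ?thesis
  proof cases
    case 1
    then show ?thesis
      by (intro obata_flat_if_central step_nilpotent_cs_2D)
  next
    case 2
    then have "obata_flat br J2 J3 J1"
      by (intro rot.obata_flat_if_central step_nilpotent_cs_2D)
    then show ?thesis
      by (simp add: obata_flat_def obata_cyclic)
  next
    case 3
    then have "obata_flat br J3 J1 J2"
      by (intro rot2.obata_flat_if_central step_nilpotent_cs_2D)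
    then show ?thesis
      by (simp add: obata_flat_def obata_cyclic rot.obata_cyclic)
  qed
qed

end
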